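(* If a graph class $\mathcal{F}$ has a $(\beta,\delta)$-padded decomposition scheme, then $\mathcal{F}$ admits a distance-invariant $\alpha$-ADT sketch of size $2$, where $\alpha=\max\left(\frac1\delta,\frac{\beta}{\log(3/2)}\right)$.
   Context: The weak diameter of $S\subseteq V(G)$ is $\max_{x,y\in S}\mathsf{dist}_G(x,y)$; $B(u,r)$ is the ball of radius $r$ around $u$. A probability distribution $\mathcal{P}$ over partitions of $V(G)$ is $(\beta,\delta,\Delta)$-padded if every partition in its support has all parts of weak diameter at most $\Delta$, and for any $u\in V(G)$ and any $0\le\gamma\le\delta$, the ball $B(u,\gamma\Delta)$ is contained in a single part of a random partition drawn from $\mathcal{P}$ with probability at least $2^{-\beta\gamma}$. $G$ admits a $(\beta,\delta)$-padded decomposition scheme if it has a $(\beta,\delta,\Delta)$-padded distribution for every $\Delta$; $\mathcal{F}$ has one if every graph in $\mathcal{F}$ does. A distance-invariant $\alpha$-ADT sketch of size $s$: a function $D:\{0,1\}^*\times\{0,1\}^*\to\{0,1\}$ such that for every $r>0$ and $G\in\mathcal{F}$ there is a distribution over $\mathsf{sk}:V(G)\to\{0,1\}^s$ with, for all $x,y$: $\mathsf{dist}_G(x,y)\le r\Rightarrow\Pr[D(\mathsf{sk}(x),\mathsf{sk}(y))=1]\ge2/3$, and $\mathsf{dist}_G(x,y)>\alpha r\Rightarrow\Pr[D(\mathsf{sk}(x),\mathsf{sk}(y))=0]\ge2/3$. $\log$ is base 2. *)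

theory Defs
  imports
    "HOL-Probability.Probability_Mass_Function"
    "HOL-Library.Disjoint_Sets"
    "Graph_Theory.Shortest_Path"
begin

text \<open>
  Finite simple graphs are those satisfying the locale predicate \<open>graph\<close> (finite symmetric
  digraphs without loops or parallel arcs).  All distributions below are over partitions of, or
  functions on, a finite vertex set, so they are given by probability mass functions.
\<close>

text \<open>The hop distance; it is \<open>\<infinity>\<close> for vertices in different components.\<close>

definition gdist :: "('a, 'b) pre_digraph \<Rightarrow> 'a \<Rightarrow> 'a \<Rightarrow> ereal" where
  "gdist G x y = wf_digraph.\<mu> G (\<lambda>_. 1) x y"

definition gball :: "('a, 'b) pre_digraph \<Rightarrow> 'a \<Rightarrow> real \<Rightarrow> 'a set" where
  "gball G u \<rho> = {v \<in> verts G. gdist G u v \<le> ereal \<rho>}"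

text \<open>Distances are taken in the whole graph.  For nonempty finite \<open>S\<close> (in particular for the
  parts of a partition) the supremum is a maximum.\<close>

definition weak_diameter :: "('a, 'b) pre_digraph \<Rightarrow> 'a set \<Rightarrow> ereal" where
  "weak_diameter G S = (SUP (x, y) \<in> S \<times> S. gdist G x y)"

definition padded ::
  "('a, 'b) pre_digraph \<Rightarrow> real \<Rightarrow> real \<Rightarrow> real \<Rightarrow> 'a set set pmf \<Rightarrow> bool" where
  "padded G \<beta> \<delta> \<Delta> \<P> \<longleftrightarrow>
     (\<forall>P \<in> set_pmf \<P>. partition_on (verts G) P \<and> (\<forall>S \<in> P. weak_diameter G S \<le> ereal \<Delta>)) \<and>
     (\<forall>u \<in> verts G. \<forall>\<gamma>. 0 \<le> \<gamma> \<and> \<gamma> \<le> \<delta> \<longrightarrow>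
        measure_pmf.prob \<P> {P. \<exists>S \<in> P. gball G u (\<gamma> * \<Delta>) \<subseteq> S} \<ge> 2 powr (- \<beta> * \<gamma>))"

definition has_padded_decomposition_scheme ::
  "('a, 'b) pre_digraph set \<Rightarrow> real \<Rightarrow> real \<Rightarrow> bool" where
  "has_padded_decomposition_scheme \<F> \<beta> \<delta> \<longleftrightarrow>
     (\<forall>G \<in> \<F>. \<forall>\<Delta> > 0. \<exists>\<P>. padded G \<beta> \<delta> \<Delta> \<P>)"

text \<open>Bit strings are Boolean lists, and the decoder's output bit 1 is \<open>True\<close>.  The decoder is
  chosen once for the class, independently of the radius and the graph.\<close>

definition admits_distance_invariant_ADT_sketch ::
  "('a, 'b) pre_digraph set \<Rightarrow> real \<Rightarrow> nat \<Rightarrow> bool" where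
  "admits_distance_invariant_ADT_sketch \<F> \<alpha> s \<longleftrightarrow>
     (\<exists>D :: bool list \<Rightarrow> bool list \<Rightarrow> bool.
        \<forall>r::real. r > 0 \<longrightarrow> (\<forall>G \<in> \<F>.
          \<exists>\<S> :: ('a \<Rightarrow> bool list) pmf.
            set_pmf \<S> \<subseteq> verts G \<rightarrow>\<^sub>E {w. length w = s} \<and>
            (\<forall>x \<in> verts G. \<forall>y \<in> verts G.
               (gdist G x y \<le> ereal r \<longrightarrow>
                  measure_pmf.prob \<S> {sk. D (sk x) (sk y)} \<ge> 2 / 3) \<and>
               (gdist G x y > ereal (\<alpha> * r) \<longrightarrow>
                  measure_pmf.prob \<S> {sk. \<not> D (sk x) (sk y)} \<ge> 2 / 3))))"

end

theory Submission
  imports Defs "HOL-Probability.Product_PMF"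
begin

text \<open>
  With \<open>\<Delta> = \<alpha> r\<close> and \<open>\<gamma> = 1 / \<alpha>\<close>, the ball of radius \<open>r\<close> around a vertex stays inside one part with
  probability at least \<open>2 powr (- \<beta> / \<alpha>) \<ge> 2 / 3\<close>, whereas vertices at distance greater than \<open>\<alpha> r\<close> are never
  in the same part.  Hash every part to two uniform independent bits and let the decoder test
  equality: near vertices collide as soon as the ball is not cut, and far vertices collide with
  probability exactly \<open>1 / 4\<close>.
\<close>

text \<open>The probability under a mixture is the average of the conditional probabilities, so a
  lower bound valid on the support of \<open>p\<close> survives. This permits conditioning on a
  partition, or on part of a hash function.\<close>

lemma measure_bind_pmf_ge:
  assumes "\<And>x. x \<in> set_pmf p \<Longrightarrow> c \<le> measure_pmf.prob (q x) E"
  shows "c \<le> measure_pmf.prob (bind_pmf p q) E"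
proof -
  have int: "integrable (measure_pmf p) (\<lambda>x. measure_pmf.prob (q x) E)"
    by (rule measure_pmf.integrable_const_bound[where B = 1]) auto
  have "c \<le> measure_pmf.expectation p (\<lambda>x. measure_pmf.prob (q x) E)"
    by (rule measure_pmf.integral_ge_const[OF int]) (auto simp: AE_measure_pmf_iff assms)
  also have "\<dots> = measure_pmf.prob (bind_pmf p q) E"
    unfolding measure_pmf_bind
    by (rule measure_pmf.measure_bind[symmetric, where N = "count_space UNIV"])
      (auto simp: measurable_def intro!: measure_pmf_in_subprob_space)
  finally show ?thesis .
qed

lemma prob_pmf_of_set_neq:
  assumes "finite W" "W \<noteq> {}"
  shows "1 - 1 / card W \<le> measure_pmf.prob (pmf_of_set W) {w. w \<noteq> v}"
proof -
  have "{w. w \<noteq> v} = UNIV - {v}" by auto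
  then have "measure_pmf.prob (pmf_of_set W) {w. w \<noteq> v} = 1 - measure_pmf.prob (pmf_of_set W) {v}"
    using measure_pmf.prob_compl[of "{v}" "pmf_of_set W"] by simp
  \<comment> \<open>Only an inequality: \<open>v\<close> may lie outside \<open>W\<close>, and then
    its probability is 0.\<close>
  moreover have "measure_pmf.prob (pmf_of_set W) {v} \<le> 1 / card W"
    using assms by (simp add: measure_pmf_single indicator_def)
  ultimately show ?thesis by simp
qed

text \<open>Draw the value at \<open>x\<close> last. Once the rest is fixed, \<open>h y\<close> is a
  constant because \<open>x\<close> and \<open>y\<close> differ, and the uniform value
  \<open>h x\<close> hits it with probability at most \<open>1 / card W\<close>. For
  \<open>y\<close> outside \<open>A\<close> the constant is \<open>d\<close>.\<close>

lemma prob_Pi_pmf_of_set_neq: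
  assumes "finite A" "x \<in> A" "x \<noteq> y" "finite W" "W \<noteq> {}"
  shows "1 - 1 / card W \<le> measure_pmf.prob (Pi_pmf A d (\<lambda>_. pmf_of_set W)) {h. h x \<noteq> h y}"
proof -
  let ?p = "pmf_of_set W"
  have "Pi_pmf A d (\<lambda>_. ?p) = Pi_pmf (insert x (A - {x})) d (\<lambda>_. ?p)"
    using assms by (simp add: insert_absorb)
  also have "\<dots> = Pi_pmf (A - {x}) d (\<lambda>_. ?p) \<bind> (\<lambda>f. map_pmf (\<lambda>w. f(x := w)) ?p)"
    using assms
    by (simp del: insert_Diff_single add: Pi_pmf_insert' map_pmf_def bind_commute_pmf[of ?p])
  finally have eq: "Pi_pmf A d (\<lambda>_. ?p) =
      Pi_pmf (A - {x}) d (\<lambda>_. ?p) \<bind> (\<lambda>f. map_pmf (\<lambda>w. f(x := w)) ?p)" .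
  show ?thesis unfolding eq
    by (rule measure_bind_pmf_ge) (use assms prob_pmf_of_set_neq in \<open>simp add: vimage_def\<close>)
qed

lemma gdist_refl_le_0:
  assumes "graph G" "x \<in> verts G"
  shows "gdist G x x \<le> 0"
proof -
  interpret graph G by fact
  have "awalk x [] x" using assms by (simp add: awalk_Nil_iff)
  then have "\<mu> (\<lambda>_. 1) x x \<le> ereal (awalk_cost (\<lambda>_. 1) [])"
    by (rule min_cost_le_walk_cost)
  then show ?thesis by (simp add: gdist_def zero_ereal_def)
qed

lemma gdist_le_weak_diameter:
  assumes "x \<in> S" "y \<in> S"
  shows "gdist G x y \<le> weak_diameter G S"
  unfolding weak_diameter_def using assms by (auto intro!: SUP_upper2[of "(x, y)"])

definition part_of :: "'a set set \<Rightarrow> 'a \<Rightarrow> 'a set" where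
  "part_of P x = (THE S. S \<in> P \<and> x \<in> S)"

lemma part_of_eq:
  assumes "partition_on V P" "S \<in> P" "x \<in> S"
  shows "part_of P x = S"
  unfolding part_of_def
  using assms by (intro the_equality) (auto dest: partition_onD2 disjointD)

lemma part_of_mem:
  assumes "partition_on V P" "x \<in> V"
  shows "part_of P x \<in> P" "x \<in> part_of P x"
proof -
  obtain S where "S \<in> P" "x \<in> S" using assms partition_onD1 by blast
  with part_of_eq[OF assms(1)] show "part_of P x \<in> P" "x \<in> part_of P x" by auto
qed

text \<open>Hash values are drawn for all subsets of \<open>V\<close>, not just for the parts of
  \<open>P\<close>, so that \<open>h\<close> is independent of \<open>P\<close>. The default has
  length \<open>s\<close>, hence so does every value of \<open>h\<close>, even outside
  \<open>Pow V\<close>.\<close>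

definition hash_sketch ::
  "'a set \<Rightarrow> nat \<Rightarrow> 'a set set pmf \<Rightarrow> ('a \<Rightarrow> bool list) pmf" where
  "hash_sketch V s \<P> = do {
     P \<leftarrow> \<P>;
     h \<leftarrow> Pi_pmf (Pow V) (replicate s False) (\<lambda>_. pmf_of_set {w. length w = s});
     return_pmf (\<lambda>x\<in>V. h (part_of P x))
   }"

lemma finite_bitstrings: "finite {w :: bool list. length w = s}"
  and card_bitstrings: "card {w :: bool list. length w = s} = 2 ^ s"
  using finite_lists_length_eq[of "UNIV :: bool set" s] card_lists_length_eq[of "UNIV :: bool set" s]
  by auto

lemma bitstrings_nonempty: "{w :: bool list. length w = s} \<noteq> {}"
  using Ex_list_of_length by blast

lemma set_hash_sketch:
  assumes "finite V"
  shows "set_pmf (hash_sketch V s \<P>) \<subseteq> V \<rightarrow>\<^sub>E {w. length w = s}"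
proof -
  let ?H = "Pi_pmf (Pow V) (replicate s False) (\<lambda>_. pmf_of_set {w :: bool list. length w = s})"
  have "set_pmf ?H \<subseteq> {h. \<forall>S. length (h S) = s}"
  proof
    fix h assume "h \<in> set_pmf ?H"
    then have "h S \<in> {w. length w = s}" for S
      using assms
      by (cases "S \<in> Pow V")
        (simp_all add: set_Pi_pmf PiE_dflt_def
          set_pmf_of_set[OF bitstrings_nonempty finite_bitstrings])
    then show "h \<in> {h. \<forall>S. length (h S) = s}" by simp
  qed
  then show ?thesis unfolding hash_sketch_def by (auto simp: subset_iff)
qed

text \<open>A coupling: when \<open>P\<close> and \<open>h\<close> are drawn together, equal parts
  force equal sketches whatever \<open>h\<close> is, so one event contains the other.\<close>

lemma prob_hash_sketch_eq:
  assumes "x \<in> V" "y \<in> V"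
  shows "measure_pmf.prob \<P> {P. part_of P x = part_of P y} \<le>
    measure_pmf.prob (hash_sketch V s \<P>) {sk. sk x = sk y}"
proof -
  let ?H = "Pi_pmf (Pow V) (replicate s False) (\<lambda>_. pmf_of_set {w :: bool list. length w = s})"
  have "hash_sketch V s \<P> = map_pmf (\<lambda>(P, h). \<lambda>x\<in>V. h (part_of P x)) (pair_pmf \<P> ?H)"
    by (simp add: hash_sketch_def pair_pmf_def map_bind_pmf)
  moreover have "measure_pmf.prob \<P> {P. part_of P x = part_of P y} =
      measure_pmf.prob (map_pmf fst (pair_pmf \<P> ?H)) {P. part_of P x = part_of P y}"
    by (simp add: map_fst_pair_pmf)
  ultimately show ?thesis
    using assms by (auto intro!: measure_pmf.finite_measure_mono)
qed

text \<open>Given \<open>P\<close>, the two parts are distinct keys with independent uniform strings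
  of length \<open>s\<close>, which agree with probability \<open>1 / 2 ^ s\<close>.\<close>

lemma prob_hash_sketch_neq:
  assumes "finite V" "x \<in> V" "y \<in> V"
    and "\<And>P. P \<in> set_pmf \<P> \<Longrightarrow> partition_on V P \<and> part_of P x \<noteq> part_of P y"
  shows "1 - 1 / 2 ^ s \<le> measure_pmf.prob (hash_sketch V s \<P>) {sk. sk x \<noteq> sk y}"
  unfolding hash_sketch_def
proof (rule measure_bind_pmf_ge)
  let ?H = "Pi_pmf (Pow V) (replicate s False) (\<lambda>_. pmf_of_set {w :: bool list. length w = s})"
  fix P assume "P \<in> set_pmf \<P>"
  then have P: "partition_on V P" "part_of P x \<noteq> part_of P y" using assms by auto
  then have "part_of P x \<in> Pow V"
    using part_of_mem[OF P(1) assms(2)] partition_onD1 by blast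
  with P show "1 - 1 / 2 ^ s \<le> measure_pmf.prob (?H \<bind> (\<lambda>h. return_pmf (\<lambda>x\<in>V. h (part_of P x))))
      {sk. sk x \<noteq> sk y}"
    using assms prob_Pi_pmf_of_set_neq[OF _ _ P(2) finite_bitstrings bitstrings_nonempty,
        where A = "Pow V" and d = "replicate s False"]
    by (simp add: map_pmf_def[symmetric] vimage_def card_bitstrings)
qed

theorem theorem5p16:
  fixes \<F> :: "('a, 'b) pre_digraph set" and \<beta> \<delta> :: real
  assumes "\<And>G. G \<in> \<F> \<Longrightarrow> graph G"
    and "\<delta> > 0"
    and "has_padded_decomposition_scheme \<F> \<beta> \<delta>"
  shows "admits_distance_invariant_ADT_sketch \<F> (max (1 / \<delta>) (\<beta> / log 2 (3 / 2))) 2"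
proof -
  define \<alpha> where "\<alpha> = max (1 / \<delta>) (\<beta> / log 2 (3 / 2))"
  have "1 / \<delta> \<le> \<alpha>" by (simp add: \<alpha>_def)
  \<comment> \<open>Positivity must come from \<open>1 / \<delta>\<close>, since the sign of \<beta>
    is arbitrary.\<close>
  moreover have "0 < 1 / \<delta>" using assms(2) by simp
  ultimately have \<alpha>_pos: "\<alpha> > 0" by linarith
  \<comment> \<open>The first term of the maximum makes \<open>1 / \<alpha>\<close> an admissible
    padding parameter.\<close>
  have \<gamma>: "0 \<le> 1 / \<alpha>" "1 / \<alpha> \<le> \<delta>"
    using \<alpha>_pos \<open>1 / \<delta> \<le> \<alpha>\<close> assms(2) by (auto simp: field_simps)
  \<comment> \<open>The second term sets the success probability, as 2 to the power
    \<open>- log 2 (3 / 2)\<close> is 2/3.\<close>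
  have "\<beta> \<le> \<alpha> * log 2 (3 / 2)"
    unfolding \<alpha>_def by (simp add: pos_divide_le_eq[symmetric])
  then have "- log 2 (3 / 2) \<le> - \<beta> * (1 / \<alpha>)"
    using \<alpha>_pos by (simp add: field_simps)
  then have "2 powr (- log 2 (3 / 2)) \<le> 2 powr (- \<beta> * (1 / \<alpha>))"
    by (intro powr_mono) auto
  then have two_thirds: "2 / 3 \<le> 2 powr (- \<beta> * (1 / \<alpha>))"
    by (simp add: powr_minus)
  show ?thesis
    unfolding admits_distance_invariant_ADT_sketch_def \<alpha>_def[symmetric]
  proof (intro exI[where x = "(=)"] allI impI ballI)
    fix r :: real and G assume "r > 0" "G \<in> \<F>"
    have "graph G" by (rule assms(1)) fact
    then interpret graph G .
    have "\<alpha> * r > 0" using \<alpha>_pos \<open>r > 0\<close> by simp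
    then obtain \<P> where \<P>: "padded G \<beta> \<delta> (\<alpha> * r) \<P>"
      using assms(3) \<open>G \<in> \<F>\<close> unfolding has_padded_decomposition_scheme_def by blast
    have part: "partition_on (verts G) P" if "P \<in> set_pmf \<P>" for P
      using \<P> that by (simp add: padded_def)
    have near: "2 / 3 \<le> measure_pmf.prob (hash_sketch (verts G) 2 \<P>) {sk. sk x = sk y}"
      if x: "x \<in> verts G" and y: "y \<in> verts G" and xy: "gdist G x y \<le> ereal r" for x y
    proof -
      note two_thirds
      also have "2 powr (- \<beta> * (1 / \<alpha>)) \<le>
          measure_pmf.prob \<P> {P. \<exists>S\<in>P. gball G x (1 / \<alpha> * (\<alpha> * r)) \<subseteq> S}"
        using \<P> x \<gamma> unfolding padded_def by blast
      also have "\<dots> = measure_pmf.prob \<P> {P. \<exists>S\<in>P. gball G x r \<subseteq> S}"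
        using \<alpha>_pos by simp
      \<comment> \<open>The inclusion of events is claimed only on the support, where
        \<open>P\<close> is a partition and a part containing the ball is the part of both
        \<open>x\<close> and \<open>y\<close>.\<close>
      also have "\<dots> \<le> measure_pmf.prob \<P> {P. part_of P x = part_of P y}"
      proof (rule measure_pmf.finite_measure_mono_AE)
        \<comment> \<open>The centre has to lie in its own ball, so that the part containing the
          ball is the part of \<open>x\<close>.\<close>
        have "gdist G x x \<le> ereal r"
          using gdist_refl_le_0[OF \<open>graph G\<close> x] \<open>r > 0\<close>
          by (metis ereal_less_eq(5) less_imp_le order_trans)
        then have "x \<in> gball G x r" "y \<in> gball G x r"
          using x y xy by (auto simp: gball_def)
        then have "part_of P x = part_of P y"
          if "P \<in> set_pmf \<P>" "S \<in> P" "gball G x r \<subseteq> S" for P S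
          using part_of_eq[OF part[OF that(1)] that(2)] that(3) by auto
        then show "AE P in \<P>. P \<in> {P. \<exists>S\<in>P. gball G x r \<subseteq> S} \<longrightarrow>
            P \<in> {P. part_of P x = part_of P y}"
          by (auto simp: AE_measure_pmf_iff)
      qed simp
      also have "\<dots> \<le> measure_pmf.prob (hash_sketch (verts G) 2 \<P>) {sk. sk x = sk y}"
        by (rule prob_hash_sketch_eq[OF x y])
      finally show ?thesis .
    qed
    have far: "2 / 3 \<le> measure_pmf.prob (hash_sketch (verts G) 2 \<P>) {sk. sk x \<noteq> sk y}"
      if x: "x \<in> verts G" and y: "y \<in> verts G" and xy: "gdist G x y > ereal (\<alpha> * r)" for x y
    proof -
      have "part_of P x \<noteq> part_of P y" if "P \<in> set_pmf \<P>" for P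
      proof
        assume "part_of P x = part_of P y"
        then have "gdist G x y \<le> weak_diameter G (part_of P x)"
          using part_of_mem[OF part[OF that]] x y by (metis gdist_le_weak_diameter)
        also have "\<dots> \<le> ereal (\<alpha> * r)"
          using \<P> that part_of_mem(1)[OF part[OF that] x] by (simp add: padded_def)
        finally show False using xy by simp
      qed
      \<comment> \<open>Two bits give 1 - 1/4 = 3/4, which exceeds 2/3; one bit would guarantee only
        1/2.\<close>
      then show ?thesis
        using prob_hash_sketch_neq[of "verts G" x y \<P> 2] x y part by auto
    qed
    show "\<exists>\<S> :: ('a \<Rightarrow> bool list) pmf. set_pmf \<S> \<subseteq> verts G \<rightarrow>\<^sub>E {w. length w = 2} \<and>
        (\<forall>x\<in>verts G. \<forall>y\<in>verts G.
          (gdist G x y \<le> ereal r \<longrightarrow> 2 / 3 \<le> measure_pmf.prob \<S> {sk. sk x = sk y}) \<and>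
          (ereal (\<alpha> * r) < gdist G x y \<longrightarrow> 2 / 3 \<le> measure_pmf.prob \<S> {sk. sk x \<noteq> sk y}))"
      using set_hash_sketch[OF finite_verts, of 2 \<P>] near far by blast
  qed
qed

end
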